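(* Let $n$ be a positive integer and let $k_1,\ldots,k_n$ be nonnegative integers. Let $\mathcal{L}(k_1,\ldots,k_n)$ be the collection of finite sequences of vectors of $V(M(n,k_1,\ldots,k_n))$ produced by the linear BTK algorithm (defined in the context). Then $\mathcal{L}(k_1,\ldots,k_n)$ is a symmetric Jordan basis of $V(M(n,k_1,\ldots,k_n))$ with respect to the up operator $U$; that is, each sequence in $\mathcal{L}(k_1,\ldots,k_n)$ is a symmetric Jordan chain with respect to $U$, and the vectors of all these sequences together form (as a disjoint union) a basis of $V(M(n,k_1,\ldots,k_n))$. Moreover, every vector in this basis has integral coefficients when expressed in the standard basis $M(n,k_1,\ldots,k_n)$.
   Context: Posets. $M(n,k_1,\ldots,k_n)=\{(x_1,\ldots,x_n)\in\mathbb{N}^n : 0\le x_i\le k_i \text{ for all } i\}$ (with $0\in\mathbb{N}$), partially ordered componentwise. It is graded with rank function $r(x_1,\ldots,x_n)=x_1+\cdots+x_n$; its rank is $r(P)=k_1+\cdots+k_n$. For a finite graded poset $P$ with rank function $r$, let $r(P)=\max_{p\in P} r(p)$, let $P_i$ be the set of elements of rank $i$, and for a finite set $S$ let $V(S)$ be the complex vector space with basis $S$. So $V(P)=\bigoplus_i V(P_i)$. A vector $v\in V(P)$ is homogeneous of rank $r(v)=i$ if $v\in V(P_i)$. The up operator $U:V(P)\to V(P)$ is the linear map with $U(p)=\sum_q q$, the sum over all $q$ covering $p$. Jordan chains. A graded Jordan chain is a sequence $(v_1,\ldots,v_h)$ of nonzero homogeneous vectors of $V(P)$ with $U(v_{i-1})=v_i$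 for $2\le i\le h$ and $U(v_h)=0$. It is a symmetric Jordan chain if in addition $r(v_1)+r(v_h)=r(P)$ (for $h=1$ this reads $2r(v_1)=r(P)$). A symmetric Jordan basis (SJB) is a basis of $V(P)$ that is a disjoint union of symmetric Jordan chains. The linear BTK algorithm. Step A (two factors). For integers $p,q\ge 0$ define recursively a collection $\mathcal{J}(p,q)$ of sequences of vectors of $V(M(2,p,q))$. If $p=0$ or $q=0$, then $M(2,p,q)$ is a chain and $\mathcal{J}(p,q)$ consists of the single sequence listing the elements of $M(2,p,q)$ in increasing order. If $p,q\ge 1$, then $\mathcal{J}(p,q)$ consists of: (1) the sequence $(v(0),v(1),\ldots,v(p+q))$, where $v(k)=\sum\binom{k}{i}(i,j)$, the sum over all $0\le i\le p$, $0\le j\le q$ with $i+j=k$; and (2) for each sequence $(w_1,\ldots,w_h)$ in $\mathcal{J}(p-1,q-1)$, the sequence $(\theta(w_1),\ldots,\theta(w_h))$, where $\theta:V(M(2,p-1,q-1))\to V(M(2,p,q))$ is the linear map with $\theta((i,j))=v(i,j+1)$, and $v(i,j)=(p-i)\,(i,j)-(q-j+1)\,(i+1,j-1)$ for $0\le i\le p-1$, $1\le j\le q$. Step B (general case, recursion on $n$). For $n=1$, $\mathcal{L}(k_1)$ consists of the single sequence $(0,1,\ldots,k_1)$ of elements of $M(1,k_1)$. For $n\ge 2$, let the sequences in $\mathcal{L}(k_1,\ldots,k_{n-1})$ be $(v(0,m),v(1,m),\ldots,v(l_m,m))$, $1\le m\le t$. For $0\le j\le k_n$ let $v(i,j,m)\in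 V(M(n,k_1,\ldots,k_n))$ be the image of $v(i,m)$ under the linear map with $(a_1,\ldots,a_{n-1})\mapsto(a_1,\ldots,a_{n-1},j)$. For each $m$ let $\psi_m:V(M(2,l_m,k_n))\to V(M(n,k_1,\ldots,k_n))$ be the linear map with $\psi_m((i,j))=v(i,j,m)$. Then $\mathcal{L}(k_1,\ldots,k_n)$ consists of all sequences $(\psi_m(w_1),\ldots,\psi_m(w_h))$ with $1\le m\le t$ and $(w_1,\ldots,w_h)\in\mathcal{J}(l_m,k_n)$. *)

theory Defs
  imports Complex_Main "HOL-Library.Poly_Mapping"
begin

section \<open>The free complex vector space on a set\<close>

text \<open>A vector is a finitely supported function \<open>'a \<Rightarrow>\<^sub>0 complex\<close>; the basis vector
  belonging to \<open>p\<close> is \<open>Poly_Mapping.single p 1\<close>.\<close>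

type_synonym 'a vec = "'a \<Rightarrow>\<^sub>0 complex"

definition cscale :: "complex \<Rightarrow> 'a vec \<Rightarrow> 'a vec" where
  "cscale c v = Poly_Mapping.map ((*) c) v"

lemma lookup_cscale [simp]:
  "Poly_Mapping.lookup (cscale c v) x = c * Poly_Mapping.lookup v x"
  by (simp add: cscale_def Poly_Mapping.map.rep_eq when_def)

global_interpretation cvec: vector_space "cscale :: complex \<Rightarrow> 'a vec \<Rightarrow> 'a vec"
  by unfold_locales (rule poly_mapping_eqI; simp add: lookup_add algebra_simps)+

abbreviation bvec :: "'a \<Rightarrow> 'a vec" where
  "bvec p \<equiv> Poly_Mapping.single p 1"

definition V :: "'a set \<Rightarrow> 'a vec set" where
  "V S = {v. Poly_Mapping.keys v \<subseteq> S}"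

text \<open>The linear map determined by the images \<open>\<phi> p\<close> of the basis vectors.\<close>

definition lin_ext :: "('a \<Rightarrow> 'b vec) \<Rightarrow> 'a vec \<Rightarrow> 'b vec" where
  "lin_ext \<phi> v = (\<Sum>p\<in>Poly_Mapping.keys v. cscale (Poly_Mapping.lookup v p) (\<phi> p))"

lemma lin_ext_bvec: "lin_ext \<phi> (bvec p) = \<phi> p"
  by (simp add: lin_ext_def)

lemma lin_ext_superset:
  assumes "finite S" "Poly_Mapping.keys v \<subseteq> S"
  shows "lin_ext \<phi> v = (\<Sum>p\<in>S. cscale (Poly_Mapping.lookup v p) (\<phi> p))"
  unfolding lin_ext_def
  by (rule sum.mono_neutral_left) (use assms in \<open>auto simp: in_keys_iff\<close>)

lemma lin_ext_linear: "Vector_Spaces.linear cscale cscale (lin_ext \<phi>)"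
proof unfold_locales
  fix c :: complex and v w :: "'a vec"
  let ?S = "Poly_Mapping.keys v \<union> Poly_Mapping.keys w"
  have "Poly_Mapping.keys (v + w) \<subseteq> ?S"
    by (rule Poly_Mapping.keys_add)
  then show "lin_ext \<phi> (v + w) = lin_ext \<phi> v + lin_ext \<phi> w"
    by (simp add: lin_ext_superset[of ?S] lookup_add cvec.scale_left_distrib sum.distrib)
  have "Poly_Mapping.keys (cscale c v) \<subseteq> Poly_Mapping.keys v"
    by (auto simp: in_keys_iff)
  then show "lin_ext \<phi> (cscale c v) = cscale c (lin_ext \<phi> v)"
    by (simp add: lin_ext_superset[of "Poly_Mapping.keys v"] cvec.scale_sum_right)
qed


section \<open>Graded posets, the up operator and symmetric Jordan bases\<close>

text \<open>A finite graded poset is given by its carrier \<open>P\<close>, its order \<open>le\<close> and its rank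
  function \<open>r\<close>.\<close>

definition covers :: "'a set \<Rightarrow> ('a \<Rightarrow> 'a \<Rightarrow> bool) \<Rightarrow> 'a \<Rightarrow> 'a \<Rightarrow> bool" where
  "covers P le q p \<longleftrightarrow> p \<in> P \<and> q \<in> P \<and> le p q \<and> p \<noteq> q \<and>
     \<not> (\<exists>z\<in>P. le p z \<and> le z q \<and> z \<noteq> p \<and> z \<noteq> q)"

definition up_op :: "'a set \<Rightarrow> ('a \<Rightarrow> 'a \<Rightarrow> bool) \<Rightarrow> 'a vec \<Rightarrow> 'a vec" where
  "up_op P le = lin_ext (\<lambda>p. \<Sum>q | covers P le q p. bvec q)"

definition poset_rank :: "'a set \<Rightarrow> ('a \<Rightarrow> nat) \<Rightarrow> nat" where
  "poset_rank P r = Max (r ` P)"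

text \<open>Since \<open>0\<close> lies in every \<open>V (P\<^sub>i)\<close>, this is a relation; a nonzero vector is
  homogeneous of at most one rank.\<close>

definition homogeneous :: "'a set \<Rightarrow> ('a \<Rightarrow> nat) \<Rightarrow> nat \<Rightarrow> 'a vec \<Rightarrow> bool" where
  "homogeneous P r i v \<longleftrightarrow> v \<in> V {p \<in> P. r p = i}"

definition graded_jordan_chain ::
  "'a set \<Rightarrow> ('a \<Rightarrow> 'a \<Rightarrow> bool) \<Rightarrow> ('a \<Rightarrow> nat) \<Rightarrow> 'a vec list \<Rightarrow> bool" where
  "graded_jordan_chain P le r vs \<longleftrightarrow> vs \<noteq> [] \<and>
     (\<forall>v\<in>set vs. v \<noteq> 0 \<and> (\<exists>i. homogeneous P r i v)) \<and>
     (\<forall>i. Suc i < length vs \<longrightarrow> up_op P le (vs ! i) = vs ! Suc i) \<and>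
     up_op P le (last vs) = 0"

definition symmetric_jordan_chain ::
  "'a set \<Rightarrow> ('a \<Rightarrow> 'a \<Rightarrow> bool) \<Rightarrow> ('a \<Rightarrow> nat) \<Rightarrow> 'a vec list \<Rightarrow> bool" where
  "symmetric_jordan_chain P le r vs \<longleftrightarrow> graded_jordan_chain P le r vs \<and>
     (\<exists>i j. homogeneous P r i (hd vs) \<and> homogeneous P r j (last vs) \<and>
        i + j = poset_rank P r)"

text \<open>\<open>distinct\<close> makes the union of the chains disjoint (no vector occurs twice).\<close>

definition symmetric_jordan_basis ::
  "'a set \<Rightarrow> ('a \<Rightarrow> 'a \<Rightarrow> bool) \<Rightarrow> ('a \<Rightarrow> nat) \<Rightarrow> 'a vec list list \<Rightarrow> bool" where
  "symmetric_jordan_basis P le r B \<longleftrightarrow>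
     (\<forall>vs\<in>set B. symmetric_jordan_chain P le r vs) \<and>
     distinct (concat B) \<and>
     cvec.independent (set (concat B)) \<and>
     cvec.span (set (concat B)) = V P"


section \<open>The poset \<open>M(n, k\<^sub>1, \<dots>, k\<^sub>n)\<close>\<close>

text \<open>Tuples are lists, and \<open>n = length ks\<close>. The order is \<open>list_all2 (\<le>)\<close>, the rank
  function \<open>sum_list\<close>.\<close>

definition M :: "nat list \<Rightarrow> nat list set" where
  "M ks = {xs. length xs = length ks \<and> (\<forall>i<length ks. xs ! i \<le> ks ! i)}"


section \<open>The linear BTK algorithm\<close>

definition btk_v :: "nat \<Rightarrow> nat \<Rightarrow> nat \<Rightarrow> nat list vec" where
  "btk_v p q k = (\<Sum>(i, j) | i \<le> p \<and> j \<le> q \<and> i + j = k.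
     cscale (of_nat (k choose i)) (bvec [i, j]))"

definition btk_w :: "nat \<Rightarrow> nat \<Rightarrow> nat \<Rightarrow> nat \<Rightarrow> nat list vec" where
  "btk_w p q i j = cscale (of_nat p - of_nat i) (bvec [i, j])
     - cscale (of_nat q - of_nat j + 1) (bvec [i + 1, j - 1])"

definition btk_theta :: "nat \<Rightarrow> nat \<Rightarrow> nat list vec \<Rightarrow> nat list vec" where
  "btk_theta p q = lin_ext (\<lambda>x. btk_w p q (x ! 0) (x ! 1 + 1))"

text \<open>Collections of sequences are lists of lists, which keeps track of multiplicities.\<close>

fun btk_J :: "nat \<Rightarrow> nat \<Rightarrow> nat list vec list list" where
  "btk_J 0 q = [map (\<lambda>j. bvec [0, j]) [0..<q + 1]]"
| "btk_J (Suc p) 0 = [map (\<lambda>i. bvec [i, 0]) [0..<Suc p + 1]]"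
| "btk_J (Suc p) (Suc q) =
     map (btk_v (Suc p) (Suc q)) [0..<Suc p + Suc q + 1]
     # map (map (btk_theta (Suc p) (Suc q))) (btk_J p q)"

definition btk_embed :: "nat \<Rightarrow> nat list vec \<Rightarrow> nat list vec" where
  "btk_embed j = lin_ext (\<lambda>a. bvec (a @ [j]))"

definition btk_psi :: "nat list vec list \<Rightarrow> nat list vec \<Rightarrow> nat list vec" where
  "btk_psi vs = lin_ext (\<lambda>x. btk_embed (x ! 1) (vs ! (x ! 0)))"

text \<open>A sequence \<open>v(0,m), \<dots>, v(l\<^sub>m,m)\<close> has length \<open>l\<^sub>m + 1\<close>.\<close>

definition btk_step :: "nat list vec list list \<Rightarrow> nat \<Rightarrow> nat list vec list list" where
  "btk_step B k = concat (map (\<lambda>vs. map (map (btk_psi vs)) (btk_J (length vs - 1) k)) B)"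

text \<open>The recursion removes the last entry; see \<open>btk_snoc\<close>. The value at \<open>[]\<close> is a dummy.\<close>

fun btk :: "nat list \<Rightarrow> nat list vec list list" where
  "btk [] = []"
| "btk (k # ks) = foldl btk_step [map (\<lambda>i. bvec [i]) [0..<k + 1]] ks"

lemma btk_snoc: "ks \<noteq> [] \<Longrightarrow> btk (ks @ [k]) = btk_step (btk ks) k"
  by (cases ks) simp_all

end

theory Submission
  imports Defs
begin

text \<open>
  The maps \<open>\<theta>\<close> and \<open>\<psi>\<^sub>m\<close> commute with the up operators and shift ranks by half the
  difference of the poset ranks, so they carry symmetric chains to symmetric chains. Linear
  independence is never checked directly: the vectors of the algorithm span, and there are as
  many of them as poset elements, so they are distinct, independent and in particular nonzero.
  For two factors, spanning holds because modulo the image of \<open>\<theta>\<close> all grid points of a fixed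
  rank are positive multiples of each other, and \<open>v(k)\<close> is a positive combination of them.
\<close>

section \<open>Linear algebra on finitely supported functions\<close>

lemma lin_ext_add: "lin_ext \<phi> (v + w) = lin_ext \<phi> v + lin_ext \<phi> w"
  and lin_ext_diff: "lin_ext \<phi> (v - w) = lin_ext \<phi> v - lin_ext \<phi> w"
  and lin_ext_cscale: "lin_ext \<phi> (cscale c v) = cscale c (lin_ext \<phi> v)"
  and lin_ext_zero [simp]: "lin_ext \<phi> 0 = 0"
  and lin_ext_sum: "lin_ext \<phi> (sum g A) = (\<Sum>a\<in>A. lin_ext \<phi> (g a))"
  and span_lin_ext_image: "cvec.span (lin_ext \<phi> ` S) = lin_ext \<phi> ` cvec.span S"
proof -
  interpret Vector_Spaces.linear cscale cscale "lin_ext \<phi>"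
    by (rule lin_ext_linear)
  show "lin_ext \<phi> (v + w) = lin_ext \<phi> v + lin_ext \<phi> w"
    "lin_ext \<phi> (v - w) = lin_ext \<phi> v - lin_ext \<phi> w"
    "lin_ext \<phi> (cscale c v) = cscale c (lin_ext \<phi> v)"
    "lin_ext \<phi> 0 = 0"
    "lin_ext \<phi> (sum g A) = (\<Sum>a\<in>A. lin_ext \<phi> (g a))"
    "cvec.span (lin_ext \<phi> ` S) = lin_ext \<phi> ` cvec.span S"
    by (rule add diff scale zero sum span_image)+
qed

lemma lin_ext_cong:
  assumes "v \<in> V S" "\<And>p. p \<in> S \<Longrightarrow> \<phi> p = \<chi> p"
  shows "lin_ext \<phi> v = lin_ext \<chi> v"
  using assms by (auto simp: lin_ext_def V_def intro!: sum.cong)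

lemma lin_ext_lin_ext: "lin_ext \<phi> (lin_ext \<chi> v) = lin_ext (\<lambda>p. lin_ext \<phi> (\<chi> p)) v"
  by (simp add: lin_ext_def[of \<chi>] lin_ext_def[of "\<lambda>p. lin_ext \<phi> (\<chi> p)"]
      lin_ext_sum lin_ext_cscale)

lemma subspace_V: "cvec.subspace (V S)"
  unfolding cvec.subspace_def V_def
  by (auto simp: in_keys_iff lookup_add) (metis add.right_neutral in_keys_iff subsetD)

lemma bvec_in_V [simp]: "bvec p \<in> V S \<longleftrightarrow> p \<in> S"
  by (simp add: V_def)

lemma V_mono: "S \<subseteq> T \<Longrightarrow> V S \<subseteq> V T"
  by (auto simp: V_def)

text \<open>Serves two purposes: bounding supports, with \<open>T\<close> of the form
  \<open>V _\<close>, and passing from basis vectors to all of \<open>V S\<close>, with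
  \<open>T\<close> a span.\<close>

lemma lin_ext_in_subspace:
  assumes "v \<in> V S" "\<And>p. p \<in> S \<Longrightarrow> \<phi> p \<in> T" "cvec.subspace T"
  shows "lin_ext \<phi> v \<in> T"
  unfolding lin_ext_def using assms
  by (intro cvec.subspace_sum cvec.subspace_scale) (auto simp: V_def)

lemma lin_ext_bvec_self: "lin_ext bvec v = v"
proof (rule poly_mapping_eqI)
  fix x
  have "Poly_Mapping.lookup (lin_ext bvec v) x
      = (\<Sum>p\<in>Poly_Mapping.keys v. if p = x then Poly_Mapping.lookup v x else 0)"
    unfolding lin_ext_def lookup_sum
    by (rule sum.cong) (auto simp: lookup_single)
  also have "\<dots> = Poly_Mapping.lookup v x"
    by (simp add: in_keys_iff)
  finally show "Poly_Mapping.lookup (lin_ext bvec v) x = Poly_Mapping.lookup v x" .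
qed

lemma span_eq_V:
  assumes "X \<subseteq> V S" "\<And>p. p \<in> S \<Longrightarrow> bvec p \<in> cvec.span X"
  shows "cvec.span X = V S"
proof
  show "cvec.span X \<subseteq> V S"
    by (rule cvec.span_minimal) (use assms subspace_V in auto)
  show "V S \<subseteq> cvec.span X"
  proof
    fix v assume "v \<in> V S"
    then have "lin_ext bvec v \<in> cvec.span X"
      by (rule lin_ext_in_subspace) (use assms in auto)
    then show "v \<in> cvec.span X"
      by (simp add: lin_ext_bvec_self)
  qed
qed

lemma independent_bvec:
  assumes "finite S"
  shows "cvec.independent (bvec ` S)"
proof (rule cvec.independent_if_scalars_zero)
  fix f x assume "(\<Sum>x\<in>bvec ` S. cscale (f x) x) = 0" "x \<in> bvec ` S"
  then obtain p where p: "x = bvec p" "p \<in> S" by blast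
  have inj: "inj_on (bvec :: 'a \<Rightarrow> 'a vec) S"
    by (auto simp: inj_on_def dest: arg_cong[where f = Poly_Mapping.keys])
  have "0 = Poly_Mapping.lookup (\<Sum>q\<in>S. cscale (f (bvec q)) (bvec q)) p"
    using \<open>(\<Sum>x\<in>bvec ` S. cscale (f x) x) = 0\<close> by (simp add: sum.reindex[OF inj])
  also have "\<dots> = (\<Sum>q\<in>S. if q = p then f (bvec p) else 0)"
    unfolding lookup_sum by (rule sum.cong) (auto simp: lookup_single)
  also have "\<dots> = f x"
    using p assms by simp
  finally show "f x = 0" by simp
qed (use assms in simp)

text \<open>A maximal independent subset \<open>B\<close> of the list still spans, so the exchange
  bound gives \<open>card S \<le> card B \<le> card (set vs) \<le> length vs = card S\<close>.
  Equality throughout yields both claims at once.\<close>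

lemma spanning_list_is_basis:
  assumes "finite S" and span: "cvec.span (set vs) = V S" and len: "length vs = card S"
  shows "distinct vs" "cvec.independent (set vs)"
proof -
  obtain B where B: "B \<subseteq> set vs" "cvec.independent B" "set vs \<subseteq> cvec.span B"
    by (rule cvec.maximal_independent_subset)
  have "finite B"
    using B(1) finite_subset by blast
  have "bvec ` S \<subseteq> cvec.span B"
    using cvec.span_minimal[OF B(3)] span by auto
  with \<open>finite B\<close> assms(1) have "card (bvec ` S :: 'a vec set) \<le> card B"
    using cvec.independent_span_bound independent_bvec by blast
  moreover have "card (bvec ` S :: 'a vec set) = card S"
    by (rule card_image) (auto simp: inj_on_def dest: arg_cong[where f = Poly_Mapping.keys])
  ultimately have "length vs \<le> card B"
    using len by simp
  moreover have "card B \<le> card (set vs)" "card (set vs) \<le> length vs"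
    using B(1) by (auto intro: card_mono card_length)
  ultimately have "card (set vs) = length vs" "card B = card (set vs)"
    by auto
  then show "distinct vs" "cvec.independent (set vs)"
    using card_distinct B card_subset_eq by blast+
qed

section \<open>Vectors with integral coefficients\<close>

definition integral_vec :: "'a vec \<Rightarrow> bool" where
  "integral_vec v \<longleftrightarrow> (\<forall>x. Poly_Mapping.lookup v x \<in> \<int>)"

lemma integral_vec_bvec [simp]: "integral_vec (bvec p)"
  by (simp add: integral_vec_def lookup_single when_def)

lemma integral_vec_cscale: "c \<in> \<int> \<Longrightarrow> integral_vec v \<Longrightarrow> integral_vec (cscale c v)"
  by (simp add: integral_vec_def)

lemma integral_vec_diff: "integral_vec v \<Longrightarrow> integral_vec w \<Longrightarrow> integral_vec (v - w)"
  by (simp add: integral_vec_def lookup_minus)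

lemma integral_vec_sum: "(\<And>a. a \<in> A \<Longrightarrow> integral_vec (g a)) \<Longrightarrow> integral_vec (sum g A)"
  by (auto simp: integral_vec_def lookup_sum intro!: Ints_sum)

text \<open>Restricting \<open>\<phi>\<close> to \<open>S\<close> matters for
  \<open>btk_psi\<close>, whose images are controlled only at indices inside the grid.\<close>

lemma integral_vec_lin_ext:
  assumes "v \<in> V S" "integral_vec v" "\<And>p. p \<in> S \<Longrightarrow> integral_vec (\<phi> p)"
  shows "integral_vec (lin_ext \<phi> v)"
  using assms unfolding lin_ext_def V_def
  by (intro integral_vec_sum integral_vec_cscale) (auto simp: integral_vec_def)


section \<open>The up operator of a product of chains\<close>

abbreviation up :: "nat list \<Rightarrow> nat list vec \<Rightarrow> nat list vec" where
  "up ks \<equiv> up_op (M ks) (list_all2 (\<le>))"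

lemma M_eq: "M ks = {xs. list_all2 (\<le>) xs ks}"
  by (auto simp: M_def list_all2_conv_all_nth)

lemma M_Nil [simp]: "M [] = {[]}"
  by (auto simp: M_eq)

lemma list_all2_snoc [simp]:
  "list_all2 R (xs @ [x]) (ys @ [y]) \<longleftrightarrow> list_all2 R xs ys \<and> R x y"
  by (cases "length xs = length ys") (auto simp: list_all2_append dest: list_all2_lengthD)

lemma snoc_in_M [simp]: "xs @ [j] \<in> M (ks @ [k]) \<longleftrightarrow> xs \<in> M ks \<and> j \<le> k"
  by (simp add: M_eq)

text \<open>Splitting off the last entry matches the direction of the recursion in
  \<open>btk\<close>.\<close>

lemma M_snoc: "M (ks @ [k]) = (\<lambda>(xs, j). xs @ [j]) ` (M ks \<times> {..k})"
proof -
  have "\<exists>ys j. xs = ys @ [j]" if "xs \<in> M (ks @ [k])" for xs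
    using that by (cases xs rule: rev_cases) (auto simp: M_def)
  then show ?thesis by fastforce
qed

lemma finite_M: "finite (M ks)"
  by (induction ks rule: rev_induct) (auto simp: M_snoc)

lemma card_M_snoc: "card (M (ks @ [k])) = card (M ks) * (k + 1)"
  unfolding M_snoc by (subst card_image) (auto simp: inj_on_def card_cartesian_product)

lemma card_M_one: "card (M [p]) = p + 1"
  using card_M_snoc[of "[]" p] by simp

lemma card_M_two: "card (M [p, q]) = (p + 1) * (q + 1)"
  using card_M_snoc[of "[p]" q] by (simp add: card_M_one)

lemma M_one: "M [p] = {[i] | i. i \<le> p}"
  by (auto simp: M_eq list_all2_Cons2)

lemma M_two: "M [p, q] = {[i, j] | i j. i \<le> p \<and> j \<le> q}"
  by (auto simp: M_eq list_all2_Cons2)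

section \<open>Ranks and covers in a product of chains\<close>

lemma sum_list_mono_nat: "list_all2 (\<le>) xs (ys :: nat list) \<Longrightarrow> sum_list xs \<le> sum_list ys"
  by (induction rule: list_all2_induct) auto

lemma list_all2_le_sum_list_eq:
  "list_all2 (\<le>) xs (ys :: nat list) \<Longrightarrow> sum_list xs = sum_list ys \<Longrightarrow> xs = ys"
proof (induction rule: list_all2_induct)
  case (Cons x xs y ys)
  then show ?case using sum_list_mono_nat[of xs ys] by auto
qed auto

lemma poset_rank_M: "poset_rank (M ks) sum_list = sum_list ks"
  unfolding poset_rank_def
proof (rule Max_eqI)
  have "ks \<in> M ks" by (simp add: M_eq list.rel_refl)
  then show "sum_list ks \<in> sum_list ` M ks" by blast
qed (use finite_M[of ks] in \<open>auto simp: M_eq sum_list_mono_nat\<close>)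

text \<open>If \<open>p\<close> lies strictly below \<open>q\<close>, raising one coordinate of
  \<open>p\<close> by 1 stays below \<open>q\<close>, so a cover must be that element. Conversely,
  anything between has the rank of \<open>p\<close> or of \<open>q\<close>, and comparable tuples of
  equal rank coincide.\<close>

lemma covers_M_iff:
  "covers (M ks) (list_all2 (\<le>)) q p \<longleftrightarrow>
     p \<in> M ks \<and> q \<in> M ks \<and> list_all2 (\<le>) p q \<and> sum_list q = sum_list p + 1"
proof
  assume cov: "covers (M ks) (list_all2 (\<le>)) q p"
  then have pq: "p \<in> M ks" "q \<in> M ks" "list_all2 (\<le>) p q" "p \<noteq> q"
    by (auto simp: covers_def)
  then obtain i where i: "i < length p" "p ! i < q ! i"
    by (metis list_all2_conv_all_nth nat_less_le nth_equalityI)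
  define z where "z = p[i := p ! i + 1]"
  have z: "list_all2 (\<le>) p z" "list_all2 (\<le>) z q" "sum_list z = sum_list p + 1"
    using pq(3) i by (auto simp: z_def list_all2_conv_all_nth nth_list_update sum_list_update)
  moreover have "z \<in> M ks"
    using z(2) pq(2) unfolding M_eq
    using list_all2_trans[of "(\<le>)" "(\<le>)" "(\<le>)" z q ks] by auto
  moreover have "z \<noteq> p" using z(3) by auto
  ultimately have "z = q"
    using cov unfolding covers_def by blast
  then show "p \<in> M ks \<and> q \<in> M ks \<and> list_all2 (\<le>) p q \<and> sum_list q = sum_list p + 1"
    using pq z by simp
next
  assume r: "p \<in> M ks \<and> q \<in> M ks \<and> list_all2 (\<le>) p q \<and> sum_list q = sum_list p + 1"
  have "z = p \<or> z = q" if "list_all2 (\<le>) p z" "list_all2 (\<le>) z q" for z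
  proof -
    have "sum_list z = sum_list p \<or> sum_list z = sum_list q"
      using r that[THEN sum_list_mono_nat] by linarith
    then show ?thesis
      using that list_all2_le_sum_list_eq by metis
  qed
  then show "covers (M ks) (list_all2 (\<le>)) q p"
    using r by (auto simp: covers_def)
qed

lemma covers_snoc:
  assumes "a \<in> M ks" "j \<le> k"
  shows "{q. covers (M (ks @ [k])) (list_all2 (\<le>)) q (a @ [j])} =
    (\<lambda>q. q @ [j]) ` {q. covers (M ks) (list_all2 (\<le>)) q a} \<union> (if j < k then {a @ [Suc j]} else {})"
    (is "?L = ?R")
proof
  show "?L \<subseteq> ?R"
  proof
    fix q assume "q \<in> ?L"
    then have q: "q \<in> M (ks @ [k])" "list_all2 (\<le>) (a @ [j]) q" "sum_list q = sum_list a + j + 1"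
      by (auto simp: covers_M_iff)
    then obtain b l where b: "q = b @ [l]" "b \<in> M ks" "l \<le> k"
      by (auto simp: M_snoc)
    then have le: "list_all2 (\<le>) a b" "j \<le> l"
      using q(2) by auto
    \<comment> \<open>Neither part can decrease and the total grows by 1, so exactly one of the two
      parts grows, by 1.\<close>
    then consider "l = j" "sum_list b = sum_list a + 1" | "l = Suc j" "a = b"
      using q(3) b(1) sum_list_mono_nat[OF le(1)] list_all2_le_sum_list_eq[OF le(1)] by force
    then show "q \<in> ?R"
      by cases (use assms b le in \<open>auto simp: covers_M_iff\<close>)
  qed
  show "?R \<subseteq> ?L"
    using assms by (auto simp: covers_M_iff list.rel_refl intro!: list_all2_appendI)
qed

lemma finite_covers: "finite {q. covers (M ks) (list_all2 (\<le>)) q a}"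
  by (rule finite_subset[OF _ finite_M[of ks]]) (auto simp: covers_def)

section \<open>The up operator after appending a factor\<close>

lemma btk_embed_bvec: "btk_embed j (bvec a) = bvec (a @ [j])"
  by (simp add: btk_embed_def lin_ext_bvec)

lemma btk_embed_zero [simp]: "btk_embed j 0 = 0"
  by (simp add: btk_embed_def)

text \<open>The two families of covers in \<open>covers_snoc\<close> are disjoint, since their last
  entries are \<open>j\<close> and \<open>Suc j\<close>; the sum therefore splits.\<close>

lemma up_bvec_snoc:
  assumes "a \<in> M ks" "j \<le> k"
  shows "up (ks @ [k]) (bvec (a @ [j])) =
    btk_embed j (up ks (bvec a)) + (if j < k then bvec (a @ [Suc j]) else 0)"
  unfolding up_op_def lin_ext_bvec covers_snoc[OF assms]
  by (subst sum.union_disjoint)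
     (auto simp: finite_covers sum.reindex inj_on_def btk_embed_def lin_ext_sum lin_ext_bvec)

text \<open>This is the tensor product rule: the up operator of a product acts on one factor at a
  time, and \<open>btk_embed j v\<close> stands for \<open>v\<close> tensor
  \<open>j\<close>.\<close>

lemma up_btk_embed:
  assumes "v \<in> V (M ks)" "j \<le> k"
  shows "up (ks @ [k]) (btk_embed j v) =
    btk_embed j (up ks v) + (if j < k then btk_embed (Suc j) v else 0)"
proof -
  have "up (ks @ [k]) (btk_embed j v) = lin_ext (\<lambda>a. up (ks @ [k]) (bvec (a @ [j]))) v"
    by (simp add: btk_embed_def up_op_def lin_ext_lin_ext)
  also have "\<dots> = lin_ext (\<lambda>a. btk_embed j (up ks (bvec a)) +
      (if j < k then bvec (a @ [Suc j]) else 0)) v"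
    by (rule lin_ext_cong[OF assms(1)]) (simp add: up_bvec_snoc assms(2))
  also have "\<dots> = lin_ext (\<lambda>a. btk_embed j (up ks (bvec a))) v +
      (if j < k then btk_embed (Suc j) v else 0)"
    by (simp add: lin_ext_def btk_embed_def cvec.scale_right_distrib sum.distrib)
  also have "lin_ext (\<lambda>a. btk_embed j (up ks (bvec a))) v = btk_embed j (up ks v)"
    by (simp add: btk_embed_def up_op_def lin_ext_lin_ext lin_ext_bvec)
  finally show ?thesis .
qed

lemma up_bvec_one:
  assumes "i \<le> p"
  shows "up [p] (bvec [i]) = (if i < p then bvec [Suc i] else 0)"
proof -
  \<comment> \<open>The empty product is a single point without covers, so one chain is the case of
    appending a factor to it.\<close>
  have "up [] (bvec []) = 0"
    by (auto simp: up_op_def lin_ext_bvec covers_def intro: sum.neutral)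
  then show ?thesis
    using up_bvec_snoc[of "[]" "[]" i p] assms by (simp add: btk_embed_def)
qed

lemma up_bvec_two:
  assumes "i \<le> p" "j \<le> q"
  shows "up [p, q] (bvec [i, j]) =
    (if i < p then bvec [Suc i, j] else 0) + (if j < q then bvec [i, Suc j] else 0)"
proof -
  have "[i] \<in> M [p]" using assms by (simp add: M_eq)
  from up_bvec_snoc[OF this assms(2)] show ?thesis
    using assms by (simp add: up_bvec_one btk_embed_bvec)
qed


section \<open>Symmetric chains\<close>

text \<open>Nonvanishing of the vectors is not included: it follows at the end from linear
  independence.\<close>

definition sym_chain :: "nat list \<Rightarrow> nat \<Rightarrow> nat list vec list \<Rightarrow> bool" where
  "sym_chain ks s vs \<longleftrightarrow> vs \<noteq> [] \<and> 2 * s + length vs = sum_list ks + 1 \<and>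
     (\<forall>i<length vs. vs ! i \<in> V {x \<in> M ks. sum_list x = s + i} \<and>
        up ks (vs ! i) = (if Suc i < length vs then vs ! Suc i else 0))"

text \<open>The last vector has rank \<open>s + length vs - 1\<close>, so the length equation in
  \<open>sym_chain\<close> is exactly the symmetry condition.\<close>

lemma sym_chain_imp_symmetric_jordan_chain:
  assumes "sym_chain ks s vs" "0 \<notin> set vs"
  shows "symmetric_jordan_chain (M ks) (list_all2 (\<le>)) sum_list vs"
proof -
  have hom: "homogeneous (M ks) sum_list (s + i) (vs ! i)" if "i < length vs" for i
    using assms that by (simp add: sym_chain_def homogeneous_def)
  have "length vs > 0"
    using assms by (simp add: sym_chain_def)
  then have "homogeneous (M ks) sum_list s (hd vs)"
    "homogeneous (M ks) sum_list (s + (length vs - 1)) (last vs)"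
    using hom[of 0] hom[of "length vs - 1"] assms
    by (auto simp: sym_chain_def hd_conv_nth last_conv_nth)
  moreover have "s + (s + (length vs - 1)) = sum_list ks"
    using assms(1) \<open>length vs > 0\<close> unfolding sym_chain_def by linarith
  moreover have "graded_jordan_chain (M ks) (list_all2 (\<le>)) sum_list vs"
    unfolding graded_jordan_chain_def
  proof (intro conjI ballI)
    fix v assume "v \<in> set vs"
    then show "v \<noteq> 0" "\<exists>i. homogeneous (M ks) sum_list i v"
      using assms(2) hom unfolding in_set_conv_nth by blast+
  qed (use assms(1) in \<open>auto simp: sym_chain_def last_conv_nth\<close>)
  ultimately show ?thesis
    unfolding symmetric_jordan_chain_def poset_rank_M by blast
qed

lemma sym_chain_set: "sym_chain ks s vs \<Longrightarrow> set vs \<subseteq> V (M ks)"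
  using V_mono[of "{x \<in> M ks. _ x}" "M ks"]
  by (fastforce simp: sym_chain_def in_set_conv_nth)

text \<open>By linearity, rank shift and commutation need checking only on basis vectors. The length
  is unchanged, so symmetry survives exactly because the poset rank grows by twice the shift
  \<open>d\<close>.\<close>

lemma sym_chain_map:
  assumes "sym_chain ks s vs"
    and rank: "sum_list ls = sum_list ks + 2 * d"
    and hom: "\<And>p. p \<in> M ks \<Longrightarrow> \<phi> p \<in> V {x \<in> M ls. sum_list x = sum_list p + d}"
    and comm: "\<And>p. p \<in> M ks \<Longrightarrow> up ls (\<phi> p) = lin_ext \<phi> (up ks (bvec p))"
  shows "sym_chain ls (s + d) (map (lin_ext \<phi>) vs)"
proof -
  have *: "lin_ext \<phi> v \<in> V {x \<in> M ls. sum_list x = s + d + i}"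
    "up ls (lin_ext \<phi> v) = lin_ext \<phi> (up ks v)"
    if v: "v \<in> V {x \<in> M ks. sum_list x = s + i}" for v i
  proof -
    show "lin_ext \<phi> v \<in> V {x \<in> M ls. sum_list x = s + d + i}"
      by (rule lin_ext_in_subspace[OF v]) (use hom in \<open>fastforce simp: subspace_V add_ac\<close>)+
    have "up ls (lin_ext \<phi> v) = lin_ext (\<lambda>p. up ls (\<phi> p)) v"
      by (simp add: up_op_def lin_ext_lin_ext)
    also have "\<dots> = lin_ext (\<lambda>p. lin_ext \<phi> (up ks (bvec p))) v"
      by (rule lin_ext_cong[OF v]) (simp add: comm)
    also have "\<dots> = lin_ext \<phi> (up ks v)"
      by (simp add: up_op_def lin_ext_lin_ext lin_ext_bvec)
    finally show "up ls (lin_ext \<phi> v) = lin_ext \<phi> (up ks v)" .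
  qed
  show ?thesis
    unfolding sym_chain_def
  proof (intro conjI allI impI)
    fix i assume "i < length (map (lin_ext \<phi>) vs)"
    then have i: "i < length vs" by simp
    then have "vs ! i \<in> V {x \<in> M ks. sum_list x = s + i}"
      "up ks (vs ! i) = (if Suc i < length vs then vs ! Suc i else 0)"
      using assms(1) by (auto simp: sym_chain_def)
    then show "map (lin_ext \<phi>) vs ! i \<in> V {x \<in> M ls. sum_list x = s + d + i}"
      "up ls (map (lin_ext \<phi>) vs ! i) =
        (if Suc i < length (map (lin_ext \<phi>) vs) then map (lin_ext \<phi>) vs ! Suc i else 0)"
      using i *[of "vs ! i" i] by simp_all
  qed (use assms(1) rank in \<open>auto simp: sym_chain_def\<close>)
qed

text \<open>Invariant of the induction: spanning together with the right number of vectors replaces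
  independence, and integrality is carried along.\<close>

definition sym_chain_basis :: "nat list \<Rightarrow> nat list vec list list \<Rightarrow> bool" where
  "sym_chain_basis ks B \<longleftrightarrow>
     (\<forall>vs\<in>set B. (\<exists>s. sym_chain ks s vs) \<and> (\<forall>v\<in>set vs. integral_vec v)) \<and>
     length (concat B) = card (M ks) \<and> (\<forall>p\<in>M ks. bvec p \<in> cvec.span (set (concat B)))"

lemma sym_chain_basis_span:
  assumes "sym_chain_basis ks B"
  shows "cvec.span (set (concat B)) = V (M ks)"
  by (rule span_eq_V) (use assms sym_chain_set in \<open>fastforce simp: sym_chain_basis_def\<close>)+

text \<open>For the base cases, where the poset is itself a chain.\<close>

lemma sym_chain_basis_singleI:
  assumes "sym_chain ks s (map bvec xs)" "length xs = card (M ks)" "M ks \<subseteq> set xs"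
  shows "sym_chain_basis ks [map bvec xs]"
  using assms by (auto simp: sym_chain_basis_def intro: cvec.span_base)


section \<open>The product of two chains\<close>

text \<open>Extension by zero off the grid, so that \<open>up_grid_vec\<close> needs no case
  distinction at the boundary.\<close>

definition grid_vec :: "nat \<Rightarrow> nat \<Rightarrow> nat \<Rightarrow> nat \<Rightarrow> nat list vec" where
  "grid_vec p q i j = (if i \<le> p \<and> j \<le> q then bvec [i, j] else 0)"

lemma up_zero [simp]: "up ks 0 = 0"
  by (simp add: up_op_def)

lemma up_grid_vec:
  "up [p, q] (grid_vec p q i j) = grid_vec p q (Suc i) j + grid_vec p q i (Suc j)"
  by (auto simp: grid_vec_def up_bvec_two)

lemma btk_v_eq: "btk_v p q k = (\<Sum>i\<le>k. cscale (of_nat (k choose i)) (grid_vec p q i (k - i)))"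
proof -
  have "{(i, j). i \<le> p \<and> j \<le> q \<and> i + j = k} = (\<lambda>i. (i, k - i)) ` {i. i \<le> k \<and> i \<le> p \<and> k - i \<le> q}"
    by (auto simp: image_iff)
  then have "btk_v p q k = (\<Sum>i | i \<le> k \<and> i \<le> p \<and> k - i \<le> q.
      cscale (of_nat (k choose i)) (bvec [i, k - i]))"
    by (simp add: btk_v_def sum.reindex inj_on_def)
  also have "\<dots> = (\<Sum>i\<le>k. cscale (of_nat (k choose i)) (grid_vec p q i (k - i)))"
    by (rule sum.mono_neutral_cong_left) (auto simp: grid_vec_def)
  finally show ?thesis .
qed

text \<open>Pascal's rule: the two summands of \<open>Suc k choose Suc i\<close> account for raising
  the first and the second coordinate.\<close>

lemma up_btk_v: "up [p, q] (btk_v p q k) = btk_v p q (Suc k)"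
proof -
  let ?e = "grid_vec p q" and ?c = "\<lambda>n i. cscale (of_nat (n choose i))"
  have "btk_v p q (Suc k) =
      ?e 0 (Suc k) + (\<Sum>i\<le>k. ?c (Suc k) (Suc i) (?e (Suc i) (k - i)))"
    unfolding btk_v_eq by (subst sum.atMost_Suc_shift) simp
  also have "\<dots> = (\<Sum>i\<le>k. ?c k i (?e (Suc i) (k - i))) +
      (?e 0 (Suc k) + (\<Sum>i\<le>k. ?c k (Suc i) (?e (Suc i) (k - i))))"
    by (simp add: cvec.scale_left_distrib sum.distrib add_ac)
  also have "?e 0 (Suc k) + (\<Sum>i\<le>k. ?c k (Suc i) (?e (Suc i) (k - i))) =
      (\<Sum>i\<le>Suc k. ?c k i (?e i (Suc k - i)))"
    by (subst sum.atMost_Suc_shift) simp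
  \<comment> \<open>The term at \<open>i = Suc k\<close> drops out because
    \<open>k choose Suc k\<close> is 0.\<close>
  also have "\<dots> = (\<Sum>i\<le>k. ?c k i (?e i (Suc (k - i))))"
    by (simp add: Suc_diff_le)
  also have "(\<Sum>i\<le>k. ?c k i (?e (Suc i) (k - i))) + \<dots> = up [p, q] (btk_v p q k)"
    unfolding btk_v_eq up_op_def lin_ext_sum lin_ext_cscale
    unfolding up_op_def[symmetric] up_grid_vec
    by (simp add: cvec.scale_right_distrib sum.distrib)
  finally show ?thesis ..
qed

lemma btk_v_in_V: "btk_v p q k \<in> V {x \<in> M [p, q]. sum_list x = k}"
  unfolding btk_v_def
  by (intro cvec.subspace_sum) (auto intro!: cvec.subspace_scale subspace_V simp: M_two)

lemma sym_chain_btk_v: "sym_chain [p, q] 0 (map (btk_v p q) [0..<p + q + 1])"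
proof -
  \<comment> \<open>Beyond the top rank \<open>p + q\<close> the defining sum is empty, which ends
    the chain.\<close>
  have "{(i, j). i \<le> p \<and> j \<le> q \<and> i + j = Suc (p + q)} = {}"
    by auto
  then have "btk_v p q (Suc (p + q)) = 0"
    unfolding btk_v_def by (simp only: sum.empty)
  then show ?thesis
    using btk_v_in_V by (auto simp: sym_chain_def up_btk_v nth_append less_Suc_eq simp del: upt_Suc)
qed

lemma integral_btk_v: "integral_vec (btk_v p q k)"
  unfolding btk_v_def by (intro integral_vec_sum) (auto intro!: integral_vec_cscale)

text \<open>Setting vectors off the grid to zero makes the formula hold for all \<open>i\<close> and \<open>j\<close>: at
  \<open>i = p + 1\<close> and at \<open>j = q + 1\<close> the surviving coefficient vanishes.\<close>

lemma btk_theta_grid_vec: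
  "btk_theta (Suc p) (Suc q) (grid_vec p q i j) =
     cscale (of_nat (Suc p) - of_nat i) (grid_vec (Suc p) (Suc q) i (Suc j)) -
     cscale (of_nat (Suc q) - of_nat j) (grid_vec (Suc p) (Suc q) (Suc i) j)"
proof (cases "i \<le> p \<and> j \<le> q")
  case True
  then show ?thesis
    by (simp add: btk_theta_def grid_vec_def lin_ext_bvec btk_w_def)
next
  case False
  then have "i = Suc p \<or> i > Suc p \<or> j = Suc q \<or> j > Suc q" by auto
  then show ?thesis
    using False by (auto simp: btk_theta_def grid_vec_def)
qed

text \<open>Both sides are combinations of the grid vectors at \<open>(i, j + 2)\<close>,
  \<open>(i + 1, j + 1)\<close> and \<open>(i + 2, j)\<close>; only the middle coefficient receives
  two contributions, and these add up to the same value on both sides.\<close>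

lemma up_btk_theta_grid_vec:
  "up [Suc p, Suc q] (btk_theta (Suc p) (Suc q) (grid_vec p q i j)) =
     btk_theta (Suc p) (Suc q) (up [p, q] (grid_vec p q i j))"
proof -
  have theta_add: "btk_theta (Suc p) (Suc q) (v + w) =
      btk_theta (Suc p) (Suc q) v + btk_theta (Suc p) (Suc q) w" for v w
    by (simp add: btk_theta_def lin_ext_add)
  have up_diff: "up ks (cscale a v - cscale b w) = cscale a (up ks v) - cscale b (up ks w)"
    for ks a b v w
    by (simp add: up_op_def lin_ext_diff lin_ext_cscale)
  show ?thesis
    unfolding btk_theta_grid_vec up_diff up_grid_vec theta_add
    by (rule poly_mapping_eqI) (simp add: lookup_add lookup_minus algebra_simps)
qed

text \<open>The shift is 1, half of the increase from \<open>p + q\<close> to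
  \<open>p + q + 2\<close>.\<close>

lemma sym_chain_btk_theta:
  assumes "sym_chain [p, q] s vs"
  shows "sym_chain [Suc p, Suc q] (s + 1) (map (btk_theta (Suc p) (Suc q)) vs)"
  unfolding btk_theta_def
proof (rule sym_chain_map[OF assms])
  let ?\<phi> = "\<lambda>x. btk_w (Suc p) (Suc q) (x ! 0) (x ! 1 + 1)"
  fix x assume "x \<in> M [p, q]"
  then obtain i j where x: "x = [i, j]" "i \<le> p" "j \<le> q" by (auto simp: M_two)
  show "?\<phi> x \<in> V {y \<in> M [Suc p, Suc q]. sum_list y = sum_list x + 1}"
    unfolding btk_w_def
    by (intro cvec.subspace_diff cvec.subspace_scale subspace_V) (use x in \<open>auto simp: M_two\<close>)
  have "bvec x = grid_vec p q i j" "?\<phi> x = btk_theta (Suc p) (Suc q) (bvec x)"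
    using x by (simp_all add: grid_vec_def btk_theta_def lin_ext_bvec)
  then show "up [Suc p, Suc q] (?\<phi> x) = lin_ext ?\<phi> (up [p, q] (bvec x))"
    using up_btk_theta_grid_vec[of p q i j] by (simp add: btk_theta_def)
qed simp

lemma integral_btk_theta:
  assumes "v \<in> V S" "integral_vec v"
  shows "integral_vec (btk_theta p q v)"
  unfolding btk_theta_def using assms
  by (rule integral_vec_lin_ext)
     (auto simp: btk_w_def intro!: integral_vec_diff integral_vec_cscale)

text \<open>The rescaled points \<open>g\<close> of one rank are congruent modulo \<open>T\<close>.
  Hence \<open>btk_v\<close> is congruent to a multiple of any one of them, and positivity of the
  coefficients keeps that multiple nonzero.\<close>

lemma bvec_in_subspace:
  assumes T: "cvec.subspace T"
    and w: "\<And>i j. i \<le> p \<Longrightarrow> j \<le> q \<Longrightarrow> btk_w (Suc p) (Suc q) i (Suc j) \<in> T"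
    and v: "\<And>k. k \<le> Suc p + Suc q \<Longrightarrow> btk_v (Suc p) (Suc q) k \<in> T"
    and i: "i \<le> Suc p" and j: "j \<le> Suc q"
  shows "bvec [i, j] \<in> T"
proof -
  define d :: "nat \<Rightarrow> nat \<Rightarrow> real" where "d i j = fact (Suc p - i) * fact (Suc q - j)" for i j
  \<comment> \<open>The factorials are chosen so that \<open>btk_w\<close> at \<open>(i, j + 1)\<close> becomes proportional to a
    difference of two values of \<open>g\<close>.\<close>
  define g :: "nat \<Rightarrow> nat \<Rightarrow> nat list vec" where
    "g i j = cscale (complex_of_real (d i j)) (bvec [i, j])" for i j
  have d: "d i j > 0" for i j
    by (simp add: d_def)
  have step: "g i (Suc j) - g (Suc i) j \<in> T" if "i \<le> p" "j \<le> q" for i j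
  proof -
    have "g i (Suc j) - g (Suc i) j =
        cscale (fact (p - i) * fact (q - j)) (btk_w (Suc p) (Suc q) i (Suc j))"
      by (rule poly_mapping_eqI)
        (use that in \<open>simp add: g_def d_def btk_w_def lookup_minus Suc_diff_le of_nat_diff
            algebra_simps\<close>)
    then show ?thesis
      using cvec.subspace_scale[OF T w[OF that]] by simp
  qed
  \<comment> \<open>Single steps along an antidiagonal telescope.\<close>
  have diff: "g i (j + m) - g (i + m) j \<in> T" if "i + m \<le> Suc p" "j + m \<le> Suc q" for i j m
    using that
  proof (induction m arbitrary: j)
    case 0
    then show ?case by (simp add: cvec.subspace_0[OF T])
  next
    case (Suc m)
    have "g i (Suc j + m) - g (i + m) (Suc j) \<in> T" "g (i + m) (Suc j) - g (Suc (i + m)) j \<in> T"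
      using Suc.prems Suc.IH[of "Suc j"] step[of "i + m" j] by auto
    from cvec.subspace_add[OF T this] show ?case by simp
  qed
  have cong: "g i' j' - g i j \<in> T" if "i' \<le> Suc p" "j' \<le> Suc q" "i' + j' = i + j" for i' j'
  proof (cases "i' \<le> i")
    case True
    then obtain m where "i = i' + m" using le_Suc_ex by blast
    then show ?thesis using diff[of i' m j] that i by (simp add: add_ac)
  next
    case False
    then obtain m where "i' = i + m" using le_Suc_ex nat_le_linear by blast
    then show ?thesis
      using cvec.subspace_neg[OF T diff[of i m j']] that j by (simp add: add_ac)
  qed
  define k where "k = i + j"
  define I where "I = {(i', j'). i' \<le> Suc p \<and> j' \<le> Suc q \<and> i' + j' = k}"
  \<comment> \<open>Coefficients of \<open>btk_v\<close> relative to the rescaled vectors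
    \<open>g\<close>.\<close>
  define c where "c = (\<lambda>(i', j'). real (k choose i') / d i' j')"
  have fin: "finite I"
    by (rule finite_subset[of _ "{..Suc p} \<times> {..Suc q}"]) (auto simp: I_def)
  have "(i, j) \<in> I"
    using i j by (simp add: I_def k_def)
  moreover have "c x > 0" if "x \<in> I" for x
    using that d by (auto simp: c_def I_def)
  ultimately have pos: "sum c I > 0"
    using fin by (intro sum_pos) auto
  have "btk_v (Suc p) (Suc q) k = (\<Sum>x\<in>I. cscale (complex_of_real (c x)) (g (fst x) (snd x)))"
    unfolding btk_v_def I_def
    by (rule sum.cong[OF refl]) (use d[THEN less_imp_neq, symmetric] in \<open>auto simp: c_def g_def\<close>)
  \<comment> \<open>Replacing every \<open>g\<close> in the sum by the fixed \<open>g i j\<close>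
    costs only differences that lie in \<open>T\<close>.\<close>
  then have "btk_v (Suc p) (Suc q) k - cscale (complex_of_real (sum c I)) (g i j) =
      (\<Sum>x\<in>I. cscale (complex_of_real (c x)) (g (fst x) (snd x) - g i j))"
    by (simp add: cvec.scale_right_diff_distrib sum_subtractf cvec.scale_sum_left)
  also have "\<dots> \<in> T"
    by (intro cvec.subspace_sum[OF T] cvec.subspace_scale[OF T]) (auto simp: I_def k_def intro: cong)
  finally have "btk_v (Suc p) (Suc q) k - cscale (complex_of_real (sum c I)) (g i j) \<in> T" .
  moreover have "btk_v (Suc p) (Suc q) k \<in> T"
    using i j by (intro v) (simp add: k_def)
  ultimately have "cscale (complex_of_real (sum c I)) (g i j) \<in> T"
    using cvec.subspace_diff[OF T] by fastforce
  from cvec.subspace_scale[OF T this]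
  have "cscale (1 / complex_of_real (sum c I * d i j))
      (cscale (complex_of_real (sum c I)) (g i j)) \<in> T" .
  then show ?thesis
    using pos d[of i j] by (simp add: g_def del: of_real_sum)
qed

lemma sym_chain_basis_btk_J: "sym_chain_basis [p, q] (btk_J p q)"
proof (induction p q rule: btk_J.induct)
  case (1 q)
  have "sym_chain_basis [0, q] [map bvec (map (\<lambda>j. [0, j]) [0..<q + 1])]"
  proof (rule sym_chain_basis_singleI)
    show "sym_chain [0, q] 0 (map bvec (map (\<lambda>j. [0, j]) [0..<q + 1]))"
      by (auto simp: sym_chain_def up_bvec_two simp del: upt_Suc) (simp_all add: M_two)
  qed (simp add: card_M_two, auto simp: M_two)
  then show ?case by (simp add: comp_def)
next
  case (2 p)
  have "sym_chain_basis [Suc p, 0] [map bvec (map (\<lambda>i. [i, 0]) [0..<Suc p + 1])]"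
  proof (rule sym_chain_basis_singleI)
    show "sym_chain [Suc p, 0] 0 (map bvec (map (\<lambda>i. [i, 0]) [0..<Suc p + 1]))"
      by (auto simp: sym_chain_def up_bvec_two simp del: upt_Suc) (simp_all add: M_two)
  qed (simp add: card_M_two, auto simp: M_two simp del: upt_Suc)
  then show ?case by (simp add: comp_def)
next
  case (3 p q)
  let ?\<theta> = "btk_theta (Suc p) (Suc q)" and ?B = "btk_J (Suc p) (Suc q)"
  have chain: "\<exists>s. sym_chain [p, q] s vs" and int: "\<forall>v\<in>set vs. integral_vec v"
    if "vs \<in> set (btk_J p q)" for vs
    using 3 that by (auto simp: sym_chain_basis_def)
  have "(\<exists>s. sym_chain [Suc p, Suc q] s vs) \<and> (\<forall>v\<in>set vs. integral_vec v)"
    if "vs \<in> set ?B" for vs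
  proof -
    from that consider "vs = map (btk_v (Suc p) (Suc q)) [0..<Suc p + Suc q + 1]"
      | us where "us \<in> set (btk_J p q)" "vs = map ?\<theta> us"
      by auto
    then show ?thesis
    proof cases
      case 1
      then show ?thesis
        using sym_chain_btk_v[of "Suc p" "Suc q"] integral_btk_v by (auto simp del: upt_Suc)
    next
      case (2 us)
      then obtain s where s: "sym_chain [p, q] s us" using chain by blast
      have "\<forall>v\<in>set us. integral_vec (?\<theta> v)"
        using sym_chain_set[OF s] int[OF 2(1)] by (auto intro: integral_btk_theta)
      then show ?thesis
        using sym_chain_btk_theta[OF s] 2 by auto
    qed
  qed
  \<comment> \<open>The count is
    \<open>(p + 1) * (q + 1) + (p + q + 3) = (p + 2) * (q + 2)\<close>.\<close>
  moreover have "length (concat ?B) = card (M [Suc p, Suc q])"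
    using 3 by (simp add: sym_chain_basis_def card_M_two length_concat comp_def)
  moreover have "bvec x \<in> cvec.span (set (concat ?B))" if "x \<in> M [Suc p, Suc q]" for x
  proof -
    \<comment> \<open>Since the smaller collection spans, its image under \<open>?\<theta>\<close>
      spans the full image, which contains all the vectors \<open>btk_w\<close>.\<close>
    have "?\<theta> ` V (M [p, q]) = cvec.span (?\<theta> ` set (concat (btk_J p q)))"
      unfolding sym_chain_basis_span[OF 3, symmetric] btk_theta_def span_lin_ext_image ..
    also have "\<dots> \<subseteq> cvec.span (set (concat ?B))"
      by (rule cvec.span_mono) auto
    finally have theta: "?\<theta> v \<in> cvec.span (set (concat ?B))" if "v \<in> V (M [p, q])" for v
      using that by blast
    have w: "btk_w (Suc p) (Suc q) i (Suc j) \<in> cvec.span (set (concat ?B))"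
      if "i \<le> p" "j \<le> q" for i j
      using theta[of "bvec [i, j]"] that by (simp add: M_two btk_theta_def lin_ext_bvec)
    have v: "btk_v (Suc p) (Suc q) k \<in> cvec.span (set (concat ?B))" if "k \<le> Suc p + Suc q" for k
      by (rule cvec.span_base) (use that in \<open>auto simp del: upt_Suc\<close>)
    from that obtain i j where "x = [i, j]" "i \<le> Suc p" "j \<le> Suc q" by (auto simp: M_two)
    then show ?thesis
      using bvec_in_subspace[OF cvec.subspace_span w v] by blast
  qed
  ultimately show ?case
    unfolding sym_chain_basis_def by blast
qed


section \<open>The recursion on the number of factors\<close>

text \<open>A chain times the new factor behaves like a two-factor grid: \<open>i\<close> moves
  along \<open>vs\<close> and \<open>j\<close> is the appended entry. The shift is the starting rank
  \<open>s\<close> of \<open>vs\<close>, since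
  \<open>sum_list ks = 2 * s + (length vs - 1)\<close>.\<close>

lemma sym_chain_btk_psi:
  assumes vs: "sym_chain ks s vs" and ws: "sym_chain [length vs - 1, k] t ws"
  shows "sym_chain (ks @ [k]) (t + s) (map (btk_psi vs) ws)"
  unfolding btk_psi_def
proof (rule sym_chain_map[OF ws])
  let ?\<phi> = "\<lambda>x. btk_embed (x ! 1) (vs ! (x ! 0))"
  have len: "length vs > 0" "2 * s + length vs = sum_list ks + 1"
    using vs by (auto simp: sym_chain_def)
  then show "sum_list (ks @ [k]) = sum_list [length vs - 1, k] + 2 * s"
    by (cases vs) auto
  fix x assume "x \<in> M [length vs - 1, k]"
  with len(1) obtain i j where x: "x = [i, j]" "i < length vs" "j \<le> k"
    by (cases vs) (auto simp: M_two)
  have vi: "vs ! i \<in> V {y \<in> M ks. sum_list y = s + i}"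
    and up_vi: "up ks (vs ! i) = (if Suc i < length vs then vs ! Suc i else 0)"
    using vs x by (auto simp: sym_chain_def)
  show "?\<phi> x \<in> V {y \<in> M (ks @ [k]). sum_list y = sum_list x + s}"
    unfolding btk_embed_def
    by (rule lin_ext_in_subspace[where S = "{y \<in> M ks. sum_list y = s + i}"])
       (use vi x in \<open>auto simp: subspace_V\<close>)
  have "vs ! i \<in> V (M ks)"
    using sym_chain_set[OF vs] x by auto
  then have "up (ks @ [k]) (?\<phi> x) = btk_embed j (if Suc i < length vs then vs ! Suc i else 0) +
      (if j < k then btk_embed (Suc j) (vs ! i) else 0)"
    using x by (simp add: up_btk_embed up_vi)
  also have "\<dots> = lin_ext ?\<phi> (up [length vs - 1, k] (bvec x))"
    using x len by (auto simp: up_bvec_two lin_ext_add lin_ext_bvec)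
  finally show "up (ks @ [k]) (?\<phi> x) = lin_ext ?\<phi> (up [length vs - 1, k] (bvec x))" .
qed

lemma integral_btk_psi:
  assumes "\<forall>v\<in>set vs. integral_vec v" "set vs \<subseteq> V S" "vs \<noteq> []"
    and "w \<in> V (M [length vs - 1, k])" "integral_vec w"
  shows "integral_vec (btk_psi vs w)"
  unfolding btk_psi_def using assms(4,5)
proof (rule integral_vec_lin_ext)
  fix x assume "x \<in> M [length vs - 1, k]"
  with assms(3) obtain i j where "x = [i, j]" "i < length vs"
    by (cases vs) (auto simp: M_two)
  then show "integral_vec (btk_embed (x ! 1) (vs ! (x ! 0)))"
    unfolding btk_embed_def
    by (intro integral_vec_lin_ext[of _ S]) (use assms in auto)
qed

text \<open>A sequence of length \<open>h\<close> contributes a grid of \<open>h * (k + 1)\<close>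
  points. The empty sequence must be excluded: truncated subtraction would let it contribute
  \<open>k + 1\<close> vectors.\<close>

lemma length_concat_btk_step:
  assumes "[] \<notin> set B"
  shows "length (concat (btk_step B k)) = length (concat B) * (k + 1)"
  using assms
proof (induction B)
  case (Cons vs B)
  have "length (concat (btk_J (length vs - 1) k)) = card (M [length vs - 1, k])"
    using sym_chain_basis_btk_J by (simp add: sym_chain_basis_def)
  also have "\<dots> = length vs * (k + 1)"
    using Cons.prems by (cases vs) (auto simp: card_M_two)
  finally show ?case
    using Cons by (simp add: btk_step_def length_concat comp_def algebra_simps)
qed (simp add: btk_step_def)

lemma sym_chain_basis_btk_step:
  assumes B: "sym_chain_basis ks B"
  shows "sym_chain_basis (ks @ [k]) (btk_step B k)"
proof -
  let ?J = "\<lambda>vs. btk_J (length vs - 1) k"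
  have chain: "\<exists>s. sym_chain ks s vs" and int: "\<forall>v\<in>set vs. integral_vec v"
    if "vs \<in> set B" for vs
    using B that by (auto simp: sym_chain_basis_def)
  then have ne: "[] \<notin> set B"
    by (auto simp: sym_chain_def)
  have "(\<exists>s. sym_chain (ks @ [k]) s us) \<and> (\<forall>u\<in>set us. integral_vec u)"
    if "us \<in> set (btk_step B k)" for us
  proof -
    from that obtain vs ws where vs: "vs \<in> set B" and ws: "ws \<in> set (?J vs)"
      and us: "us = map (btk_psi vs) ws"
      by (auto simp: btk_step_def)
    obtain s where s: "sym_chain ks s vs"
      using chain vs by blast
    obtain t where t: "sym_chain [length vs - 1, k] t ws" and int_ws: "\<forall>w\<in>set ws. integral_vec w"
      using sym_chain_basis_btk_J ws unfolding sym_chain_basis_def by blast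
    have "integral_vec (btk_psi vs w)" if "w \<in> set ws" for w
      by (rule integral_btk_psi[OF int[OF vs] sym_chain_set[OF s]])
         (use that vs ne sym_chain_set[OF t] int_ws in auto)
    then show ?thesis
      using sym_chain_btk_psi[OF s t] us by auto
  qed
  moreover have "length (concat (btk_step B k)) = card (M (ks @ [k]))"
    using B by (simp add: length_concat_btk_step[OF ne] card_M_snoc sym_chain_basis_def)
  moreover have "bvec x \<in> cvec.span (set (concat (btk_step B k)))" if "x \<in> M (ks @ [k])" for x
  proof -
    from that obtain a j where x: "x = a @ [j]" "a \<in> M ks" "j \<le> k"
      by (auto simp: M_snoc)
    \<comment> \<open>Each \<open>v(i,j,m)\<close> is the image of a grid point under \<psi>, and
      the two-factor collection spans the whole grid space.\<close>
    have "btk_embed j ` set (concat B) \<subseteq> cvec.span (set (concat (btk_step B k)))"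
    proof clarify
      fix v assume "v \<in> set (concat B)"
      then obtain vs i where vs: "vs \<in> set B" and i: "i < length vs" and v: "v = vs ! i"
        by (auto simp: in_set_conv_nth)
      have "btk_embed j v = btk_psi vs (bvec [i, j])"
        by (simp add: v btk_psi_def lin_ext_bvec)
      also have "\<dots> \<in> btk_psi vs ` V (M [length vs - 1, k])"
        using i x by (intro imageI) (auto simp: M_two)
      also have "\<dots> = cvec.span (btk_psi vs ` set (concat (?J vs)))"
        unfolding sym_chain_basis_span[OF sym_chain_basis_btk_J, symmetric]
          btk_psi_def span_lin_ext_image ..
      also have "\<dots> \<subseteq> cvec.span (set (concat (btk_step B k)))"
        by (rule cvec.span_mono) (use vs in \<open>fastforce simp: btk_step_def\<close>)
      finally show "btk_embed j v \<in> cvec.span (set (concat (btk_step B k)))" .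
    qed
    then have "cvec.span (btk_embed j ` set (concat B)) \<subseteq> cvec.span (set (concat (btk_step B k)))"
      by (rule cvec.span_minimal) simp
    moreover have "bvec x \<in> btk_embed j ` cvec.span (set (concat B))"
      using B x by (auto simp: sym_chain_basis_def btk_embed_bvec intro!: rev_image_eqI)
    ultimately show ?thesis
      unfolding btk_embed_def span_lin_ext_image by blast
  qed
  ultimately show ?thesis
    unfolding sym_chain_basis_def by blast
qed

lemma sym_chain_basis_btk: "ks \<noteq> [] \<Longrightarrow> sym_chain_basis ks (btk ks)"
proof (induction ks rule: rev_induct)
  case (snoc k ks)
  show ?case
  proof (cases "ks = []")
    \<comment> \<open>A single factor is the true start of the recursion; \<open>btk []\<close> is
      only a dummy.\<close>
    case True
    have "sym_chain_basis [k] [map bvec (map (\<lambda>i. [i]) [0..<k + 1])]"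
    proof (rule sym_chain_basis_singleI)
      show "sym_chain [k] 0 (map bvec (map (\<lambda>i. [i]) [0..<k + 1]))"
        by (auto simp: sym_chain_def up_bvec_one simp del: upt_Suc) (simp_all add: M_one)
    qed (simp add: card_M_one, auto simp: M_one)
    then show ?thesis using True by (simp add: comp_def)
  next
    case False
    then show ?thesis
      using snoc.IH by (simp add: btk_snoc sym_chain_basis_btk_step)
  qed
qed simp

theorem theorem1p1:
  fixes n :: nat and ks :: "nat list"
  assumes "n \<ge> 1" and "length ks = n"
  shows "symmetric_jordan_basis (M ks) (list_all2 (\<le>)) sum_list (btk ks)
    \<and> (\<forall>v\<in>set (concat (btk ks)). \<forall>x\<in>M ks. Poly_Mapping.lookup v x \<in> \<int>)"
proof -
  have B: "sym_chain_basis ks (btk ks)"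
    using assms by (intro sym_chain_basis_btk) auto
  note span = sym_chain_basis_span[OF B]
  have "length (concat (btk ks)) = card (M ks)"
    using B by (simp add: sym_chain_basis_def)
  note basis = spanning_list_is_basis[OF finite_M span this]
  \<comment> \<open>Independence excludes the zero vector, which supplies the nonvanishing left out
    of \<open>sym_chain\<close>.\<close>
  have "0 \<notin> set (concat (btk ks))"
    using basis(2) cvec.dependent_zero by blast
  then have "\<forall>vs\<in>set (btk ks). symmetric_jordan_chain (M ks) (list_all2 (\<le>)) sum_list vs"
    using B by (fastforce simp: sym_chain_basis_def intro: sym_chain_imp_symmetric_jordan_chain)
  then have "symmetric_jordan_basis (M ks) (list_all2 (\<le>)) sum_list (btk ks)"
    using span basis by (simp add: symmetric_jordan_basis_def)
  then show ?thesis
    using B by (auto simp: sym_chain_basis_def integral_vec_def)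
qed

end
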